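(* There exist universal constants $a, a', b > 0$ such that the following holds. Let $p$ be a prime such that $2$ is a primitive root modulo $p$ (i.e. $2$ generates $\mathbf{F}_p^\times$), let $d = p-1$ and $q = 2^d$, and represent $\mathbf{F}_q = \mathbf{F}_2[x]/(1+x+\cdots+x^d)$ (the polynomial $1+x+\cdots+x^d$ being irreducible over $\mathbf{F}_2$). Let $K$ be the transition matrix of the Markov chain on $\mathbf{F}_q$ given by $X_n = X_{n-1}^2 + \varepsilon_n$, where the $\varepsilon_n$ are independent and identically distributed with $\Pr(\varepsilon_n = 0) = \tfrac12$ and $\Pr(\varepsilon_n = x^i) = \tfrac{1}{2d}$ for $i = 0, 1, \dots, d-1$. Let $\pi$ be the uniform probability measure on $\mathbf{F}_q$. Then: (1) for every real $c > 0$ such that $n = \tfrac12 d(\log(d) + c)$ is an integer, $$\|K^n(0,\cdot) - \pi\|_{TV} \le a e^{-bc};$$ (2) for every real $c > 0$ such that $n = \tfrac12 d(\log(d) - c)$ is a nonnegative integer, $$\|K^n(0,\cdot) - \pi\|_{TV} \ge 1 - a' e^{-bc}.$$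
   Context: $\log$ is the natural logarithm. $K^n(\alpha,\beta)$ denotes the probability that the chain moves from $\alpha$ to $\beta$ in $n$ steps, so $K^n(0,\cdot)$ is the distribution of $X_n$ when $X_0 = 0$. For probability measures $P, Q$ on $\mathbf{F}_q$, the total variation distance is $\|P - Q\|_{TV} = \frac12 \sum_{\alpha \in \mathbf{F}_q} |P(\alpha) - Q(\alpha)|$. The constants are universal: they do not depend on $p$, $d$, $n$ or $c$. *)

theory Defs
  imports
    "HOL-Probability.Probability"
    "HOL-Library.Z2"
    "HOL-Number_Theory.Residue_Primitive_Roots"
    "HOL-Algebra.Algebraic_Closure_Type"
    "HOL-Algebra.QuotRing"
begin

definition poly_ring_F2 :: "bit poly ring" where
  "poly_ring_F2 = ring_of_type_algebra"

definition all_ones_poly :: "nat \<Rightarrow> bit poly" where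
  "all_ones_poly d = (\<Sum>i\<le>d. Polynomial.monom 1 i)"

definition all_ones_ideal :: "nat \<Rightarrow> bit poly set" where
  "all_ones_ideal d = PIdl\<^bsub>poly_ring_F2\<^esub> (all_ones_poly d)"

text \<open>The ring \<open>F\<^sub>2[x]/(1 + x + \<dots> + x\<^sup>d)\<close>, whose elements are cosets. It is a field
  with \<open>2\<^sup>d\<close> elements when \<open>d + 1\<close> is a prime modulo which 2 is a primitive root.\<close>

definition Fq :: "nat \<Rightarrow> bit poly set ring" where
  "Fq d = poly_ring_F2 Quot all_ones_ideal d"

definition x_power :: "nat \<Rightarrow> nat \<Rightarrow> bit poly set" where
  "x_power d i = all_ones_ideal d +>\<^bsub>poly_ring_F2\<^esub> Polynomial.monom 1 i"

text \<open>The classes of \<open>1, x, \<dots>, x\<^bsup>d-1\<^esup>\<close> are pairwise distinct and nonzero, so each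
  of them receives mass \<open>1/(2d)\<close>. Only \<open>d > 0\<close> is meaningful.\<close>

definition noise_pmf :: "nat \<Rightarrow> bit poly set pmf" where
  "noise_pmf d =
     bind_pmf (bernoulli_pmf (1/2)) (\<lambda>zero.
       if zero then return_pmf \<zero>\<^bsub>Fq d\<^esub>
       else map_pmf (x_power d) (pmf_of_set {..<d}))"

text \<open>A transition matrix \<open>K\<close> is represented by its rows: \<open>K(\<alpha>,\<beta>)\<close> is
  \<open>pmf (K \<alpha>) \<beta>\<close>. Drawing the noise afresh at every application encodes the independence
  of the \<open>\<epsilon>\<^sub>n\<close>.\<close>

definition square_kernel :: "nat \<Rightarrow> bit poly set \<Rightarrow> bit poly set pmf" where
  "square_kernel d \<alpha> =
     map_pmf (\<lambda>e. \<alpha> [^]\<^bsub>Fq d\<^esub> (2::nat) \<oplus>\<^bsub>Fq d\<^esub> e) (noise_pmf d)"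

primrec kernel_power :: "('a \<Rightarrow> 'a pmf) \<Rightarrow> nat \<Rightarrow> 'a \<Rightarrow> 'a pmf" where
  "kernel_power K 0 \<alpha> = return_pmf \<alpha>"
| "kernel_power K (Suc n) \<alpha> = bind_pmf (kernel_power K n \<alpha>) K"

definition tv_dist :: "'a set \<Rightarrow> 'a pmf \<Rightarrow> 'a pmf \<Rightarrow> real" where
  "tv_dist S P Q = (1/2) * (\<Sum>\<alpha>\<in>S. \<bar>pmf P \<alpha> - pmf Q \<alpha>\<bar>)"

definition tv_from_uniform :: "nat \<Rightarrow> nat \<Rightarrow> real" where
  "tv_from_uniform d n =
     tv_dist (carrier (Fq d))
       (kernel_power (square_kernel d) n \<zero>\<^bsub>Fq d\<^esub>) (pmf_of_set (carrier (Fq d)))"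

end

theory Submission
  imports Defs
begin

text \<open>
  The chain is the image of a walk on a cube. Let \<open>p = d + 1\<close>. Since
  \<open>x\<^sup>p - 1 = (x - 1) (1 + x + \<dots> + x\<^sup>d)\<close>, the ring \<open>F\<^sub>2[x]/(1 + x + \<dots> + x\<^sup>d)\<close> is a quotient of
  \<open>F\<^sub>2[x]/(x\<^sup>p - 1)\<close>, whose elements are the subsets of \<open>{0, \<dots>, p - 1}\<close>; the fibres are the
  pairs consisting of a set and its complement. On subsets, squaring merely permutes the
  coordinates by doubling modulo \<open>p\<close>, and the noise flips a uniformly chosen coordinate other
  than \<open>d\<close> with probability 1/2. So up to the permutation the process is the lazy walk on the
  cube, apart from the single coordinate that is protected from the noise at each step. The
  coordinate protected \<open>k\<close> steps before the end finally sits at \<open>2\<^sup>k d\<close> modulo \<open>p\<close>; as 2 is a primitive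
  root, this runs evenly through all nonzero residues.

  The characters of the cube are indexed by sets \<open>S\<close>, and the \<open>n\<close>-step Fourier coefficient is the
  explicit product of the factors \<open>1 - card (S\<^sub>k - {d}) / d\<close>, where \<open>S\<^sub>k\<close> is the preimage of \<open>S\<close> under
  multiplication by \<open>2\<^sup>k\<close> (\<open>fourier_cube_walk\<close>).

  Upper bound: projecting does not increase total variation, so it suffices to mix on the cube.
  There Cauchy--Schwarz and Parseval bound the squared distance by the sum of the squared
  coefficients over nonempty \<open>S\<close> (\<open>tv_uniform_fourier_bound\<close>). A coefficient is at most \<open>z\<close> to the
  power \<open>card S\<close> with \<open>z\<close> close to \<open>exp (- n / d)\<close> (\<open>fourier_cube_walk_le\<close>), so the sum is at most
  \<open>(1 + z\<^sup>2)\<^sup>p - 1\<close>, which decays exponentially in \<open>c\<close>.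

  Lower bound: the sum \<open>W\<close> of the coordinate signs is defined on the quotient up to sign. Under
  the uniform law its second moment is \<open>p\<close>. Under the chain its mean is at least
  \<open>p (1 - 1 / d)\<^sup>n\<close>, and its variance is at most \<open>p\<close> because distinct coordinates are negatively
  correlated (\<open>fourier_cube_walk_Un_le\<close>). Hence the size of \<open>W\<close> separates the two laws.
\<close>

section \<open>Fourier analysis on the cube and total variation\<close>

definition chi :: "'a set \<Rightarrow> 'a set \<Rightarrow> real" where
  "chi S A = (-1) ^ card (S \<inter> A)"

lemma chi_empty [simp]: "chi {} A = 1" "chi S {} = 1"
  by (simp_all add: chi_def)

lemma chi_commute: "chi S A = chi A S"
  by (simp add: chi_def Int_commute)

lemma chi_square [simp]: "chi S A * chi S A = 1"
  by (simp add: chi_def flip: power_add)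

lemma chi_singleton: "chi {i} A = (if i \<in> A then -1 else 1)"
  by (simp add: chi_def)

text \<open>The product form turns every identity between characters into a pointwise one.\<close>

lemma chi_eq_prod:
  assumes "finite S"
  shows "chi S A = (\<Prod>i\<in>S. if i \<in> A then -1 else 1)"
proof -
  have "(\<Prod>i\<in>S. if i \<in> A then -1 else 1 :: real) = (\<Prod>i\<in>S \<inter> A. -1)"
    using assms by (rule prod.inter_restrict[symmetric])
  then show ?thesis by (simp add: chi_def)
qed

lemma chi_sym_diff:
  assumes "finite S"
  shows "chi S (sym_diff A B) = chi S A * chi S B"
  unfolding chi_eq_prod[OF assms] prod.distrib[symmetric] by (rule prod.cong) auto

lemma chi_Un_disjoint:
  assumes "finite S" "finite T" "S \<inter> T = {}"
  shows "chi (S \<union> T) A = chi S A * chi T A"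
  using assms by (simp add: chi_eq_prod prod.union_disjoint)

lemma sum_chi:
  assumes "finite U" "B \<subseteq> U"
  shows "(\<Sum>S\<in>Pow U. chi S B) = (if B = {} then 2 ^ card U else 0)"
proof -
  have "(\<Sum>S\<in>Pow U. chi S B)
      = (\<Sum>S\<in>Pow U. (\<Prod>i\<in>S. if i \<in> B then -1 else 1) * (\<Prod>i\<in>U-S. 1))"
    using assms by (intro sum.cong) (auto simp: chi_eq_prod finite_subset)
  also have "\<dots> = (\<Prod>i\<in>U. (if i \<in> B then -1 else 1) + 1)"
    by (rule prod_add[OF assms(1), symmetric])
  also have "\<dots> = (if B = {} then 2 ^ card U else 0)"
    using assms by (auto intro!: prod_zero)
  finally show ?thesis .
qed

text \<open>A product of two characters is the character of the symmetric difference, and a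
  nontrivial character averages to zero because the sum factors over the coordinates.\<close>

lemma chi_orthogonal:
  assumes "finite U" "A \<subseteq> U" "B \<subseteq> U"
  shows "(\<Sum>S\<in>Pow U. chi S A * chi S B) = (if A = B then 2 ^ card U else 0)"
proof -
  have "(\<Sum>S\<in>Pow U. chi S A * chi S B) = (\<Sum>S\<in>Pow U. chi S (sym_diff A B))"
    using assms by (intro sum.cong refl chi_sym_diff[symmetric]) (auto simp: finite_subset)
  also have "\<dots> = (if sym_diff A B = {} then 2 ^ card U else 0)"
    using assms by (intro sum_chi) auto
  also have "sym_diff A B = {} \<longleftrightarrow> A = B" by auto
  finally show ?thesis .
qed

definition fourier :: "'a set pmf \<Rightarrow> 'a set \<Rightarrow> real" where
  "fourier P S = measure_pmf.expectation P (chi S)"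

lemma fourier_eq_sum:
  assumes "finite U" "set_pmf P \<subseteq> Pow U"
  shows "fourier P S = (\<Sum>A\<in>Pow U. pmf P A * chi S A)"
  unfolding fourier_def using assms
  by (subst integral_measure_pmf[of "Pow U"]) auto

lemma fourier_empty [simp]: "fourier P {} = 1"
proof -
  have "chi {} = (\<lambda>A::'a set. 1)" by auto
  then show ?thesis by (simp add: fourier_def)
qed

lemma parseval:
  assumes "finite U" "set_pmf P \<subseteq> Pow U"
  shows "(\<Sum>S\<in>Pow U. (fourier P S)\<^sup>2) = 2 ^ card U * (\<Sum>A\<in>Pow U. (pmf P A)\<^sup>2)"
proof -
  have "(\<Sum>S\<in>Pow U. (fourier P S)\<^sup>2)
      = (\<Sum>S\<in>Pow U. \<Sum>A\<in>Pow U. \<Sum>B\<in>Pow U. pmf P A * pmf P B * (chi S A * chi S B))"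
    by (simp add: fourier_eq_sum[OF assms] power2_eq_square sum_product mult_ac)
  also have "\<dots> = (\<Sum>A\<in>Pow U. \<Sum>B\<in>Pow U. \<Sum>S\<in>Pow U. pmf P A * pmf P B * (chi S A * chi S B))"
    by (subst sum.swap, rule sum.cong[OF refl], rule sum.swap)
  also have "\<dots> = (\<Sum>A\<in>Pow U. \<Sum>B\<in>Pow U. if A = B then pmf P A * pmf P B * 2 ^ card U else 0)"
    using assms(1)
    by (intro sum.cong refl) (simp add: sum_distrib_left[symmetric] chi_orthogonal)
  also have "\<dots> = (\<Sum>A\<in>Pow U. pmf P A * pmf P A * 2 ^ card U)"
    using assms(1) by (intro sum.cong refl) (simp add: sum.delta')
  finally show ?thesis by (simp add: sum_distrib_left power2_eq_square mult_ac)
qed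

text \<open>The upper bound lemma of Diaconis and Shahshahani on the cube: Cauchy--Schwarz replaces
  the L1 distance by the L2 distance, which Parseval evaluates. The coefficient at the empty
  set is 1 and accounts for the uniform part.\<close>

lemma tv_uniform_fourier_bound:
  assumes "finite U" "set_pmf P \<subseteq> Pow U"
  shows "(2 * tv_dist (Pow U) P (pmf_of_set (Pow U)))\<^sup>2 \<le> (\<Sum>S\<in>Pow U - {{}}. (fourier P S)\<^sup>2)"
proof -
  define N :: real where "N = 2 ^ card U"
  have N: "N > 0" "card (Pow U) = N" using assms(1) by (simp_all add: N_def card_Pow)
  have uniform: "pmf (pmf_of_set (Pow U)) A = 1 / N" if "A \<in> Pow U" for A
    using that assms(1) N(2) Pow_not_empty[of U] by (subst pmf_of_set) auto
  have one: "(\<Sum>A\<in>Pow U. pmf P A) = 1"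
    using assms by (intro sum_pmf_eq_1) auto
  have "(2 * tv_dist (Pow U) P (pmf_of_set (Pow U)))\<^sup>2 = (\<Sum>A\<in>Pow U. 1 * \<bar>pmf P A - 1 / N\<bar>)\<^sup>2"
    using uniform by (simp add: tv_dist_def)
  also have "\<dots> \<le> (\<Sum>A\<in>Pow U. 1\<^sup>2) * (\<Sum>A\<in>Pow U. \<bar>pmf P A - 1 / N\<bar>\<^sup>2)"
    by (rule Cauchy_Schwarz_ineq_sum)
  also have "\<dots> = N * (\<Sum>A\<in>Pow U. (pmf P A)\<^sup>2 - 2 / N * pmf P A + 1 / N\<^sup>2)"
    by (simp add: N power2_diff power_divide mult_ac algebra_simps)
  also have "(\<Sum>A\<in>Pow U. (pmf P A)\<^sup>2 - 2 / N * pmf P A + 1 / N\<^sup>2)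
      = (\<Sum>A\<in>Pow U. (pmf P A)\<^sup>2) - 1 / N"
    using N one
    by (simp add: sum.distrib sum_subtractf sum_distrib_left[symmetric] sum_divide_distrib[symmetric] power2_eq_square)
  also have "N * \<dots> = (\<Sum>S\<in>Pow U. (fourier P S)\<^sup>2) - 1"
    using N(1) parseval[OF assms] by (simp add: N_def algebra_simps)
  also have "\<dots> = (\<Sum>S\<in>Pow U - {{}}. (fourier P S)\<^sup>2)"
    using assms(1) by (simp add: sum_diff1)
  finally show ?thesis .
qed

lemma sum_powers_nonempty_subsets:
  fixes z :: real
  assumes "finite U"
  shows "(\<Sum>S\<in>Pow U - {{}}. z ^ card S) = (1 + z) ^ card U - 1"
proof -
  have "(1 + z) ^ card U = (\<Prod>i\<in>U. z + 1)" by (simp add: add.commute)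
  also have "\<dots> = (\<Sum>S\<in>Pow U. (\<Prod>i\<in>S. z) * (\<Prod>i\<in>U-S. 1))"
    by (rule prod_add[OF assms])
  finally show ?thesis using assms by (simp add: sum_diff1)
qed

lemma pmf_map_eq_sum:
  assumes "finite \<Omega>" "set_pmf P \<subseteq> \<Omega>"
  shows "pmf (map_pmf f P) y = (\<Sum>x | x\<in>\<Omega> \<and> f x = y. pmf P x)"
proof -
  have "pmf (map_pmf f P) y = measure P (f -` {y})" by (rule pmf_map)
  also have "\<dots> = measure P {x\<in>\<Omega>. f x = y}"
    using assms by (intro measure_prob_cong_0) (auto simp: set_pmf_iff subset_iff)
  also have "\<dots> = (\<Sum>x | x\<in>\<Omega> \<and> f x = y. pmf P x)"
    using assms by (intro measure_measure_pmf_finite) auto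
  finally show ?thesis .
qed

text \<open>Data processing: mass that cancels within a fibre can only lower the distance.\<close>

lemma tv_dist_map_le:
  assumes "finite \<Omega>" "set_pmf P \<subseteq> \<Omega>" "set_pmf Q \<subseteq> \<Omega>"
  shows "tv_dist (f ` \<Omega>) (map_pmf f P) (map_pmf f Q) \<le> tv_dist \<Omega> P Q"
proof -
  have "(\<Sum>y\<in>f ` \<Omega>. \<bar>pmf (map_pmf f P) y - pmf (map_pmf f Q) y\<bar>)
      = (\<Sum>y\<in>f ` \<Omega>. \<bar>\<Sum>x | x\<in>\<Omega> \<and> f x = y. pmf P x - pmf Q x\<bar>)"
    using assms by (simp add: pmf_map_eq_sum sum_subtractf)
  also have "\<dots> \<le> (\<Sum>y\<in>f ` \<Omega>. \<Sum>x | x\<in>\<Omega> \<and> f x = y. \<bar>pmf P x - pmf Q x\<bar>)"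
    by (intro sum_mono sum_abs)
  also have "\<dots> = (\<Sum>x\<in>\<Omega>. \<bar>pmf P x - pmf Q x\<bar>)"
    using assms(1) by (rule sum.image_gen[symmetric])
  finally show ?thesis by (simp add: tv_dist_def)
qed

lemma prob_diff_le_tv_dist:
  assumes "finite \<Omega>" "set_pmf P \<subseteq> \<Omega>" "set_pmf Q \<subseteq> \<Omega>"
  shows "measure_pmf.prob P E - measure_pmf.prob Q E \<le> tv_dist \<Omega> P Q"
proof -
  let ?D = "\<lambda>x. pmf P x - pmf Q x"
  have prob: "measure_pmf.prob R E = (\<Sum>x\<in>\<Omega> \<inter> E. pmf R x)" if "set_pmf R \<subseteq> \<Omega>" for R
  proof -
    have "measure_pmf.prob R E = measure_pmf.prob R (\<Omega> \<inter> E)"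
      using that by (intro measure_prob_cong_0) (auto simp: set_pmf_iff subset_iff)
    then show ?thesis using assms(1) by (simp add: measure_measure_pmf_finite)
  qed
  have zero: "(\<Sum>x\<in>\<Omega>. ?D x) = 0"
    using assms by (simp add: sum_subtractf sum_pmf_eq_1)
  have split: "(\<Sum>x\<in>\<Omega>. g x) = (\<Sum>x\<in>\<Omega> \<inter> E. g x) + (\<Sum>x\<in>\<Omega> - E. g x)" for g :: "'a \<Rightarrow> real"
    by (metis assms(1) sum.Int_Diff)
  have a: "(\<Sum>x\<in>\<Omega> \<inter> E. ?D x) \<le> (\<Sum>x\<in>\<Omega> \<inter> E. \<bar>?D x\<bar>)" "- (\<Sum>x\<in>\<Omega> - E. ?D x) \<le> (\<Sum>x\<in>\<Omega> - E. \<bar>?D x\<bar>)"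
    by (auto intro!: sum_mono simp: sum_negf[symmetric] simp del: sum_subtractf)
  have "measure_pmf.prob P E - measure_pmf.prob Q E = (\<Sum>x\<in>\<Omega> \<inter> E. ?D x)"
    using assms by (simp add: prob sum_subtractf)
  then show ?thesis
    using split[of ?D] split[of "\<lambda>x. \<bar>?D x\<bar>"] zero a unfolding tv_dist_def by linarith
qed

lemma tv_dist_nonneg: "0 \<le> tv_dist \<Omega> P Q"
  by (simp add: tv_dist_def sum_nonneg)

text \<open>A statistic whose mean is large compared with its standard deviation is rarely small.\<close>

lemma (in prob_space) prob_abs_le_half_mean:
  assumes "random_variable borel f" "integrable M (\<lambda>x. (f x)\<^sup>2)" "\<mu> > 0"
    "expectation f \<ge> \<mu>"
  shows "prob {x \<in> space M. \<bar>f x\<bar> \<le> \<mu> / 2} \<le> 4 * variance f / \<mu>\<^sup>2"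
proof -
  have "prob {x \<in> space M. \<bar>f x\<bar> \<le> \<mu> / 2}
      \<le> prob {x \<in> space M. \<bar>f x - expectation f\<bar> \<ge> \<mu> / 2}"
    using assms by (intro finite_measure_mono) auto
  also have "\<dots> \<le> variance f / (\<mu> / 2)\<^sup>2"
    using assms by (intro Chebyshev_inequality) auto
  finally show ?thesis by (simp add: power_divide mult.commute)
qed

section \<open>The walk on subsets of the residues modulo \<open>p\<close>\<close>

text \<open>Subsets of \<open>{0, \<dots>, p - 1}\<close> stand for the elements of \<open>F\<^sub>2[x]/(x\<^sup>p - 1)\<close>: the set
  collects the exponents that occur. There addition is symmetric difference and squaring is
  doubling of exponents.\<close>

definition double_mod :: "nat \<Rightarrow> nat \<Rightarrow> nat" where
  "double_mod p i = 2 * i mod p"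

definition cube_noise :: "nat \<Rightarrow> nat set pmf" where
  "cube_noise d =
     bind_pmf (bernoulli_pmf (1/2)) (\<lambda>zero.
       if zero then return_pmf {} else map_pmf (\<lambda>i. {i}) (pmf_of_set {..<d}))"

definition cube_kernel :: "nat \<Rightarrow> nat \<Rightarrow> nat set \<Rightarrow> nat set pmf" where
  "cube_kernel p d A = map_pmf (\<lambda>E. sym_diff (double_mod p ` A) E) (cube_noise d)"

abbreviation cube_walk :: "nat \<Rightarrow> nat \<Rightarrow> nat \<Rightarrow> nat set pmf" where
  "cube_walk p d n \<equiv> kernel_power (cube_kernel p d) n {}"

locale primroot2 =
  fixes p d :: nat
  assumes p_eq: "p = Suc d" and prime: "Factorial_Ring.prime p" and primroot: "residue_primroot p 2"
begin

abbreviation "U \<equiv> {..<p}"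
abbreviation "dbl \<equiv> double_mod p"

lemma coprime_2: "coprime p 2"
  using primroot by (simp add: residue_primroot_def)

lemma ord_2: "ord p 2 = d"
  using primroot prime p_eq by (simp add: residue_primroot_def totient_prime)

lemma p_ge_3: "p \<ge> 3"
proof -
  have "p \<noteq> 2" using coprime_2 by auto
  then show ?thesis using prime_ge_2_nat[OF prime] by simp
qed

lemma d_ge_2: "d \<ge> 2"
  using p_ge_3 p_eq by auto

lemma d_less_p: "d < p"
  using p_eq by simp

lemma U_eq: "U = insert d {..<d}"
  using p_eq by auto

lemma dbl_in_U [simp]: "dbl i \<in> U"
  using p_ge_3 by (simp add: double_mod_def)

lemma power_mult_inj:
  assumes "i < p" "j < p" "2 ^ k * i mod p = 2 ^ k * j mod p"
  shows "i = j"
proof -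
  have "coprime (2 ^ k) p" using coprime_2 by (simp add: coprime_commute)
  then have "[i = j] (mod p)"
    using assms(3) cong_mult_lcancel_nat[of "2 ^ k" p i j] by (simp add: cong_def)
  then show ?thesis using assms by (simp add: cong_def)
qed

lemma inj_on_dbl: "inj_on dbl U"
  by (rule inj_onI, rule power_mult_inj[where k = 1]) (simp_all add: double_mod_def)

text \<open>Pulling a character back along \<open>k\<close> squarings replaces its index set by this preimage.
  Multiplication by \<open>2\<^sup>k\<close> permutes the residues, so the size does not change.\<close>

definition doubling_preimage :: "nat \<Rightarrow> nat set \<Rightarrow> nat set" where
  "doubling_preimage k S = {i \<in> U. 2 ^ k * i mod p \<in> S}"

lemma doubling_preimage_subset [simp]: "doubling_preimage k S \<subseteq> U"
  and finite_doubling_preimage [simp]: "finite (doubling_preimage k S)"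
  by (auto simp: doubling_preimage_def)

lemma doubling_preimage_0: "S \<subseteq> U \<Longrightarrow> doubling_preimage 0 S = S"
  by (auto simp: doubling_preimage_def subset_iff)

lemma doubling_preimage_doubling_preimage_1: "doubling_preimage k (doubling_preimage 1 S) = doubling_preimage (Suc k) S"
  using p_ge_3 by (auto simp: doubling_preimage_def mod_mult_right_eq mult.assoc)

lemma doubling_preimage_Un: "doubling_preimage k (S \<union> T) = doubling_preimage k S \<union> doubling_preimage k T"
  and doubling_preimage_Int: "doubling_preimage k (S \<inter> T) = doubling_preimage k S \<inter> doubling_preimage k T"
  by (auto simp: doubling_preimage_def)

lemma card_doubling_preimage:
  assumes "S \<subseteq> U"
  shows "card (doubling_preimage k S) = card S"
proof -
  let ?f = "\<lambda>i. 2 ^ k * i mod p"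
  have inj: "inj_on ?f U" by (rule inj_onI, rule power_mult_inj[where k = k]) simp_all
  have "?f ` U = U"
    using p_ge_3 by (intro endo_inj_surj inj) auto
  then have "?f ` doubling_preimage k S = S" using assms by (auto simp: doubling_preimage_def)
  moreover have "inj_on ?f (doubling_preimage k S)" using inj by (rule inj_on_subset) simp
  ultimately show ?thesis by (metis card_image)
qed

lemma set_pmf_cube_noise: "set_pmf (cube_noise d) \<subseteq> Pow U"
  using d_ge_2 p_eq by (auto simp: cube_noise_def lessThan_empty_iff split: if_splits)

lemma set_pmf_cube_kernel: "A \<subseteq> U \<Longrightarrow> set_pmf (cube_kernel p d A) \<subseteq> Pow U"
  using set_pmf_cube_noise dbl_in_U by (auto simp: cube_kernel_def)

lemma set_pmf_cube_walk: "set_pmf (cube_walk p d n) \<subseteq> Pow U"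
proof (induction n)
  case (Suc n)
  have "set_pmf (cube_kernel p d A) \<subseteq> Pow U" if "A \<in> set_pmf (cube_walk p d n)" for A
    using that Suc by (intro set_pmf_cube_kernel) auto
  then show ?case unfolding kernel_power.simps set_bind_pmf by (rule UN_least)
qed simp

text \<open>The noise never selects the exponent \<open>d\<close>, so the element \<open>d\<close> of \<open>S\<close> has no influence on
  the coefficient. This asymmetry is what distinguishes the walk from the ordinary lazy walk on
  the cube.\<close>

lemma fourier_cube_noise:
  assumes "S \<subseteq> U"
  shows "fourier (cube_noise d) S = 1 - card (S - {d}) / d"
proof -
  have fin: "finite {..<d}" "{..<d} \<noteq> {}" using d_ge_2 by (auto simp: lessThan_empty_iff)
  have "S - {d} = S \<inter> {..<d}" using assms p_eq by (auto simp: subset_iff less_Suc_eq)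
  have chi1: "chi S {i} = (if i \<in> S then -1 else 1)" for i
    by (subst chi_commute) (simp add: chi_singleton)
  have "fourier (cube_noise d) S = (\<Sum>b\<in>UNIV. pmf (bernoulli_pmf (1/2)) b *\<^sub>R
      measure_pmf.expectation (if b then return_pmf {} else map_pmf (\<lambda>i. {i}) (pmf_of_set {..<d})) (chi S))"
    unfolding fourier_def cube_noise_def using fin
    by (intro pmf_expectation_bind) (auto simp: set_pmf_of_set)
  also have "\<dots> = 1/2 + 1/2 * ((\<Sum>i<d. chi S {i}) / d)"
    using fin by (simp add: UNIV_bool integral_pmf_of_set)
  also have "(\<Sum>i<d. chi S {i}) = (\<Sum>i<d. 1 - 2 * (if i \<in> S then 1 else 0))"
    by (intro sum.cong) (auto simp: chi1)
  also have "\<dots> = real d - 2 * (\<Sum>i<d. if i \<in> S then 1 else 0)"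
    by (simp add: sum_subtractf sum_distrib_left)
  also have "(\<Sum>i<d. if i \<in> S then 1 else 0) = real (card (S - {d}))"
    unfolding \<open>S - {d} = S \<inter> {..<d}\<close> sum.inter_restrict[OF fin(1), symmetric]
    by (simp add: Int_commute)
  finally show ?thesis using d_ge_2 by (simp add: field_simps)
qed

lemma chi_image_dbl:
  assumes "A \<subseteq> U"
  shows "chi S (dbl ` A) = chi (doubling_preimage 1 S) A"
proof -
  have "S \<inter> dbl ` A = dbl ` (doubling_preimage 1 S \<inter> A)"
    using assms by (auto simp: doubling_preimage_def double_mod_def)
  moreover have "inj_on dbl (doubling_preimage 1 S \<inter> A)"
    using inj_on_dbl by (rule inj_on_subset) (use assms in auto)
  ultimately show ?thesis by (simp add: chi_def card_image)
qed

text \<open>The increment is independent of the past and characters are multiplicative; hence the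
  coefficients satisfy an exact recursion along the orbit of \<open>S\<close> under doubling.\<close>

lemma fourier_cube_walk_Suc:
  assumes "S \<subseteq> U"
  shows "fourier (cube_walk p d (Suc n)) S
      = fourier (cube_noise d) S * fourier (cube_walk p d n) (doubling_preimage 1 S)"
proof -
  have finS: "finite S" using assms finite_subset by blast
  have fin: "finite (set_pmf (cube_kernel p d A))" if "A \<in> Pow U" for A
    using set_pmf_cube_kernel[of A] that by (auto intro: finite_subset)
  have kernel: "measure_pmf.expectation (cube_kernel p d A) (chi S)
      = fourier (cube_noise d) S * chi (doubling_preimage 1 S) A" if "A \<in> Pow U" for A
    using that finS by (simp add: cube_kernel_def chi_sym_diff chi_image_dbl fourier_def)
  have "fourier (cube_walk p d (Suc n)) S
      = (\<Sum>A\<in>Pow U. pmf (cube_walk p d n) A *\<^sub>R measure_pmf.expectation (cube_kernel p d A) (chi S))"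
    unfolding fourier_def kernel_power.simps
    by (rule pmf_expectation_bind) (use fin set_pmf_cube_walk in auto)
  also have "\<dots> = (\<Sum>A\<in>Pow U. pmf (cube_walk p d n) A * (fourier (cube_noise d) S * chi (doubling_preimage 1 S) A))"
    using kernel by simp
  also have "\<dots> = fourier (cube_noise d) S * fourier (cube_walk p d n) (doubling_preimage 1 S)"
    by (simp add: fourier_eq_sum[OF _ set_pmf_cube_walk] sum_distrib_left mult_ac)
  finally show ?thesis .
qed

lemma fourier_cube_walk:
  assumes "S \<subseteq> U"
  shows "fourier (cube_walk p d n) S = (\<Prod>k<n. 1 - card (doubling_preimage k S - {d}) / d)"
  using assms
proof (induction n arbitrary: S)
  case 0
  then show ?case by (simp add: fourier_def)
next
  case (Suc n)
  have "fourier (cube_walk p d (Suc n)) S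
      = (1 - card (doubling_preimage 0 S - {d}) / d) * (\<Prod>k<n. 1 - card (doubling_preimage k (doubling_preimage 1 S) - {d}) / d)"
    using Suc by (simp add: fourier_cube_walk_Suc fourier_cube_noise doubling_preimage_0 del: kernel_power.simps)
  then show ?case
    by (simp only: doubling_preimage_doubling_preimage_1 prod.lessThan_Suc_shift o_def)
qed

lemma factor_bounds:
  "0 \<le> 1 - card (doubling_preimage k S - {d}) / real d" "1 - card (doubling_preimage k S - {d}) / real d \<le> 1"
proof -
  have "doubling_preimage k S - {d} \<subseteq> {..<d}" using U_eq by (auto simp: doubling_preimage_def)
  then have "card (doubling_preimage k S - {d}) \<le> d" by (metis card_lessThan card_mono finite_lessThan)
  then show "0 \<le> 1 - card (doubling_preimage k S - {d}) / real d" using d_ge_2 by (simp add: field_simps)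
qed simp

lemma fourier_cube_walk_nonneg: "S \<subseteq> U \<Longrightarrow> 0 \<le> fourier (cube_walk p d n) S"
  by (simp only: fourier_cube_walk) (intro prod_nonneg factor_bounds)

text \<open>Negative correlation of characters with disjoint index sets, valid factor by factor since
  \<open>1 - (s + t)/d \<le> (1 - s/d) (1 - t/d)\<close>. It bounds the variance in the lower bound.\<close>

lemma fourier_cube_walk_Un_le:
  assumes "S \<subseteq> U" "T \<subseteq> U" "S \<inter> T = {}"
  shows "fourier (cube_walk p d n) (S \<union> T) \<le> fourier (cube_walk p d n) S * fourier (cube_walk p d n) T"
proof -
  have "1 - card (doubling_preimage k (S \<union> T) - {d}) / d
      \<le> (1 - card (doubling_preimage k S - {d}) / d) * (1 - card (doubling_preimage k T - {d}) / d)" for k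
  proof -
    have "doubling_preimage k S \<inter> doubling_preimage k T = {}"
      using assms(3) by (simp add: doubling_preimage_Int[symmetric]) (simp add: doubling_preimage_def)
    then have "card (doubling_preimage k (S \<union> T) - {d}) = card (doubling_preimage k S - {d}) + card (doubling_preimage k T - {d})"
      by (subst card_Un_disjoint[symmetric]) (auto simp: doubling_preimage_Un Un_Diff)
    then show ?thesis by (simp add: algebra_simps add_divide_distrib)
  qed
  then have "(\<Prod>k<n. 1 - card (doubling_preimage k (S \<union> T) - {d}) / d)
      \<le> (\<Prod>k<n. (1 - card (doubling_preimage k S - {d}) / d) * (1 - card (doubling_preimage k T - {d}) / d))"
    by (intro prod_mono conjI factor_bounds)
  then show ?thesis
    using assms by (simp add: fourier_cube_walk prod.distrib)
qed

lemma fourier_cube_walk_singleton_ge: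
  assumes "i < p"
  shows "(1 - 1 / d) ^ n \<le> fourier (cube_walk p d n) {i}"
proof -
  have "(\<Prod>k<n. 1 - 1 / real d) \<le> (\<Prod>k<n. 1 - card (doubling_preimage k {i} - {d}) / d)"
  proof (intro prod_mono conjI)
    fix k
    have "card (doubling_preimage k {i} - {d}) \<le> card (doubling_preimage k {i})" by (intro card_mono) auto
    also have "\<dots> = 1" using assms by (simp add: card_doubling_preimage)
    finally show "1 - 1 / real d \<le> 1 - card (doubling_preimage k {i} - {d}) / d"
      by (simp add: divide_right_mono)
  qed (use d_ge_2 in simp)
  then show ?thesis using assms by (simp add: fourier_cube_walk)
qed

text \<open>Here primitivity of 2 enters: powers of 2 repeat modulo \<open>p\<close> with period exactly \<open>d\<close>, so
  the orbit of \<open>d\<close> meets a given residue at most once in each block of \<open>d\<close> consecutive steps.\<close>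

lemma card_doubling_visits_le:
  assumes "j < p"
  shows "real (card {k\<in>{..<n}. 2 ^ k * d mod p = j}) \<le> real n / d + 1"
proof -
  let ?K = "{k\<in>{..<n}. 2 ^ k * d mod p = j}"
  have cong: "k mod d = l mod d" if "k \<in> ?K" "l \<in> ?K" for k l
  proof -
    have "coprime d p" using p_eq by (metis coprime_Suc_right_nat)
    moreover have "[2 ^ k * d = 2 ^ l * d] (mod p)" using that by (simp add: cong_def)
    ultimately have "[2 ^ k = 2 ^ l] (mod p)" using cong_mult_rcancel_nat by blast
    then show ?thesis
      using order_divides_expdiff[OF coprime_2] ord_2 by (simp add: cong_def)
  qed
  have "inj_on (\<lambda>k. k div d) ?K"
  proof (rule inj_onI)
    fix k l assume "k \<in> ?K" "l \<in> ?K" "k div d = l div d"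
    then have "k div d * d + k mod d = l div d * d + l mod d" using cong[of k l] by simp
    then show "k = l" by (simp only: div_mult_mod_eq)
  qed
  moreover have "(\<lambda>k. k div d) ` ?K \<subseteq> {..n div d}"
    by (auto intro!: div_le_mono)
  ultimately have "card ?K \<le> card {..n div d}"
    by (rule card_inj_on_le) simp
  then have "real (card ?K) \<le> real (n div d) + 1" by simp
  then show ?thesis using of_nat_div_le_of_nat[of n d, where 'a = real] by linarith
qed

text \<open>At step \<open>k\<close> the factor is \<open>1 - m/d\<close> with \<open>m = card S\<close>, or \<open>1 - (m - 1)/d\<close> if the residue
  of \<open>2\<^sup>k d\<close> lies in \<open>S\<close>. Using \<open>1 - x \<le> exp (- x)\<close>, the exceptional steps cost a factor
  \<open>exp (1/d)\<close> each, and there are at most \<open>m (n/d + 1)\<close> of them.\<close>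

lemma fourier_cube_walk_le:
  assumes "S \<subseteq> U"
  shows "fourier (cube_walk p d n) S \<le> exp (- (real n - real n / d - 1) / d) ^ card S"
proof -
  let ?m = "card S"
  let ?hit = "\<lambda>k. if 2 ^ k * d mod p \<in> S then 1 else 0 :: real"
  have finS: "finite S" using assms finite_subset by blast
  have "fourier (cube_walk p d n) S = (\<Prod>k<n. 1 - card (doubling_preimage k S - {d}) / d)"
    using assms by (rule fourier_cube_walk)
  also have "\<dots> \<le> (\<Prod>k<n. exp (- (?m - ?hit k) / d))"
  proof (intro prod_mono conjI factor_bounds)
    fix k
    have "real (card (doubling_preimage k S - {d})) = ?m - ?hit k"
    proof (cases "d \<in> doubling_preimage k S")
      case True
      then have "card (doubling_preimage k S) > 0" by (auto simp: card_gt_0_iff)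
      moreover have "2 ^ k * d mod p \<in> S" using True by (simp add: doubling_preimage_def)
      ultimately show ?thesis using True assms by (simp add: card_doubling_preimage of_nat_diff)
    next
      case False
      then have "2 ^ k * d mod p \<notin> S" using d_less_p by (simp add: doubling_preimage_def)
      then show ?thesis using False assms by (simp add: card_doubling_preimage)
    qed
    then show "1 - card (doubling_preimage k S - {d}) / real d \<le> exp (- (?m - ?hit k) / d)"
      using exp_ge_add_one_self[of "- (?m - ?hit k) / d"]
      by (simp only: minus_divide_left[symmetric] add_uminus_conv_diff)
  qed
  also have "\<dots> = exp (- (\<Sum>k<n. ?m - ?hit k) / d)"
    by (simp only: exp_sum[OF finite_lessThan, symmetric] sum_divide_distrib[symmetric] sum_negf)
  also have "(\<Sum>k<n. ?m - ?hit k) = real n * ?m - (\<Sum>k<n. ?hit k)"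
    by (simp add: sum_subtractf)
  \<comment> \<open>count the exceptional steps separately for each residue that is hit\<close>
  also have "(\<Sum>k<n. ?hit k) = (\<Sum>k<n. \<Sum>j\<in>S. if 2 ^ k * d mod p = j then 1 else 0)"
    using finS by (intro sum.cong) auto
  also have "\<dots> = (\<Sum>j\<in>S. \<Sum>k<n. if 2 ^ k * d mod p = j then 1 else 0)"
    by (rule sum.swap)
  also have "\<dots> = (\<Sum>j\<in>S. real (card {k\<in>{..<n}. 2 ^ k * d mod p = j}))"
    by (intro sum.cong refl) (simp add: sum.inter_filter[symmetric])
  also have "exp (- (real n * ?m - (\<Sum>j\<in>S. real (card {k\<in>{..<n}. 2 ^ k * d mod p = j}))) / d)
      \<le> exp (?m * (- (real n - real n / d - 1) / d))"
  proof -
    have "(\<Sum>j\<in>S. real (card {k\<in>{..<n}. 2 ^ k * d mod p = j})) \<le> ?m * (real n / d + 1)"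
      using card_doubling_visits_le assms by (intro sum_bounded_above) auto
    then have "- (real n * ?m - (\<Sum>j\<in>S. real (card {k\<in>{..<n}. 2 ^ k * d mod p = j})))
        \<le> ?m * - (real n - real n / d - 1)"
      by (simp add: algebra_simps)
    then show ?thesis by (simp add: divide_right_mono)
  qed
  finally show ?thesis by (simp only: exp_of_nat_mult)
qed

end

section \<open>The quotient ring as a quotient of the cube\<close>

definition subset_poly :: "nat set \<Rightarrow> bit poly" where
  "subset_poly A = (\<Sum>i\<in>A. Polynomial.monom 1 i)"

definition residue_class :: "nat \<Rightarrow> bit poly \<Rightarrow> bit poly set" where
  "residue_class d f = all_ones_ideal d +>\<^bsub>poly_ring_F2\<^esub> f"

abbreviation subset_class :: "nat \<Rightarrow> nat set \<Rightarrow> bit poly set" where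
  "subset_class d A \<equiv> residue_class d (subset_poly A)"

lemma coeff_subset_poly:
  "finite A \<Longrightarrow> poly.coeff (subset_poly A) i = (if i \<in> A then 1 else 0)"
  by (simp add: subset_poly_def coeff_sum)

lemma subset_poly_eq_iff:
  assumes "finite A" "finite B"
  shows "subset_poly A = subset_poly B \<longleftrightarrow> A = B"
  using assms by (auto simp: poly_eq_iff coeff_subset_poly set_eq_iff split: if_splits)

lemma subset_poly_sym_diff:
  assumes "finite A" "finite B"
  shows "subset_poly (sym_diff A B) = subset_poly A + subset_poly B"
  by (rule poly_eqI) (use assms in \<open>auto simp: coeff_subset_poly\<close>)

lemma bit_poly_diff_eq_add: "f - g = f + (g :: bit poly)"
  by (rule poly_eqI) simp

lemma all_ones_poly_eq: "all_ones_poly d = subset_poly {..d}"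
  by (simp add: all_ones_poly_def subset_poly_def)

lemma degree_all_ones_poly [simp]: "Polynomial.degree (all_ones_poly d) = d"
  by (intro antisym degree_le le_degree) (auto simp: all_ones_poly_eq coeff_subset_poly)

lemma carrier_poly_ring_F2 [simp]: "carrier poly_ring_F2 = UNIV"
  and mult_poly_ring_F2 [simp]: "f \<otimes>\<^bsub>poly_ring_F2\<^esub> g = f * g"
  and add_poly_ring_F2 [simp]: "f \<oplus>\<^bsub>poly_ring_F2\<^esub> g = f + g"
  and zero_poly_ring_F2 [simp]: "\<zero>\<^bsub>poly_ring_F2\<^esub> = 0"
  by (simp_all add: poly_ring_F2_def ring_of_type_algebra_def)

lemma cring_poly_ring_F2: "cring poly_ring_F2"
  unfolding poly_ring_F2_def by (rule cring_from_type_algebra)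

lemma ideal_all_ones: "ideal (all_ones_ideal d) poly_ring_F2"
  unfolding all_ones_ideal_def by (intro cring.cgenideal_ideal cring_poly_ring_F2) simp

lemma mem_all_ones_ideal: "f \<in> all_ones_ideal d \<longleftrightarrow> all_ones_poly d dvd f"
  by (auto simp: all_ones_ideal_def cgenideal_def dvd_def mult.commute)

lemma residue_class_alt: "residue_class d f = {g. all_ones_poly d dvd g - f}"
proof -
  have "g \<in> residue_class d f \<longleftrightarrow> all_ones_poly d dvd g - f" for g
    unfolding residue_class_def a_r_coset_def'
    by (auto simp: mem_all_ones_ideal intro!: bexI[of _ "g - f"])
  then show ?thesis by blast
qed

lemma residue_class_eq_iff:
  "residue_class d f = residue_class d g \<longleftrightarrow> all_ones_poly d dvd f - g"
proof
  assume "residue_class d f = residue_class d g"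
  then have "f \<in> residue_class d g" by (metis (no_types, lifting) residue_class_alt mem_Collect_eq diff_self dvd_0_right)
  then show "all_ones_poly d dvd f - g" by (simp add: residue_class_alt)
next
  assume dvd: "all_ones_poly d dvd f - g"
  have "all_ones_poly d dvd h - f \<longleftrightarrow> all_ones_poly d dvd h - g" for h
    using dvd_add_left_iff[OF dvd, of "h - f"] by simp
  then show "residue_class d f = residue_class d g" by (simp add: residue_class_alt)
qed

lemma carrier_Fq: "carrier (Fq d) = range (residue_class d)"
  by (auto simp: Fq_def FactRing_def A_RCOSETS_def' residue_class_def)

lemma ring_Fq: "ring (Fq d)"
  unfolding Fq_def by (rule ideal.quotient_is_ring[OF ideal_all_ones])

lemma residue_class_hom: "residue_class d \<in> ring_hom poly_ring_F2 (Fq d)"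
  unfolding Fq_def residue_class_def[abs_def] by (rule ideal.rcos_ring_hom[OF ideal_all_ones])

lemma residue_class_add: "residue_class d f \<oplus>\<^bsub>Fq d\<^esub> residue_class d g = residue_class d (f + g)"
  using ring_hom_add[OF residue_class_hom, of f g d] by simp

lemma residue_class_0: "residue_class d 0 = \<zero>\<^bsub>Fq d\<^esub>"
  using ring_hom_zero[OF residue_class_hom cring.axioms(1)[OF cring_poly_ring_F2] ring_Fq] by simp

lemma residue_class_square: "residue_class d f [^]\<^bsub>Fq d\<^esub> (2::nat) = residue_class d (f\<^sup>2)"
proof -
  interpret ring "Fq d" by (rule ring_Fq)
  have "residue_class d f \<in> carrier (Fq d)" by (simp add: carrier_Fq)
  then have "residue_class d f [^]\<^bsub>Fq d\<^esub> (2::nat) = residue_class d f \<otimes>\<^bsub>Fq d\<^esub> residue_class d f"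
    by (simp add: numeral_2_eq_2)
  then show ?thesis
    using ring_hom_mult[OF residue_class_hom, of f f d] by (simp add: power2_eq_square)
qed

lemma x_power_eq: "x_power d i = subset_class d {i}"
  by (simp add: x_power_def residue_class_def subset_poly_def)

lemma noise_pmf_eq: "noise_pmf d = map_pmf (subset_class d) (cube_noise d)"
proof -
  have "subset_class d {} = \<zero>\<^bsub>Fq d\<^esub>"
    by (simp add: subset_poly_def residue_class_0)
  then show ?thesis
    unfolding noise_pmf_def cube_noise_def map_bind_pmf
    by (intro bind_pmf_cong refl) (simp add: pmf.map_comp o_def x_power_eq[abs_def])
qed

text \<open>In the quotient \<open>x\<^sup>p = 1\<close> for \<open>p = d + 1\<close>, because \<open>x\<^sup>p - 1 = (x - 1) (1 + x + \<dots> + x\<^sup>d)\<close>.\<close>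

lemma all_ones_dvd_monom_diff:
  "all_ones_poly d dvd Polynomial.monom 1 (k + Suc d) - Polynomial.monom 1 k"
proof -
  define x :: "bit poly" where "x = Polynomial.monom 1 1"
  have x: "x ^ i = Polynomial.monom 1 i" for i by (simp add: x_def monom_power)
  have "x ^ Suc d - 1 = (x - 1) * (\<Sum>i<Suc d. x ^ i)" by (rule power_diff_1_eq)
  also have "(\<Sum>i<Suc d. x ^ i) = all_ones_poly d"
    by (simp add: x all_ones_poly_def lessThan_Suc_atMost)
  finally have ones: "x ^ Suc d - 1 = (x - 1) * all_ones_poly d" .
  have "x ^ (k + Suc d) - x ^ k = x ^ k * (x ^ Suc d - 1)"
    by (simp only: power_add right_diff_distrib mult_1_right)
  also have "\<dots> = all_ones_poly d * (x ^ k * (x - 1))"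
    unfolding ones by (simp only: mult_ac)
  finally have "x ^ (k + Suc d) - x ^ k = all_ones_poly d * (x ^ k * (x - 1))" .
  then show ?thesis unfolding x by simp
qed

context primroot2
begin

text \<open>Squaring is additive in characteristic 2, so it acts on exponents by doubling, and
  exponents only matter modulo \<open>p\<close>.\<close>

lemma subset_class_image_dbl:
  assumes "A \<subseteq> U"
  shows "residue_class d ((subset_poly A)\<^sup>2) = subset_class d (dbl ` A)"
proof -
  have "finite A" using assms finite_subset by blast
  then have "all_ones_poly d dvd (subset_poly A)\<^sup>2 - subset_poly (dbl ` A)"
    using assms
  proof (induction rule: finite_induct)
    case empty
    then show ?case by (simp add: subset_poly_def)
  next
    case (insert i A)
    have "dbl i \<notin> dbl ` A"
      using insert inj_on_image_mem_iff[OF inj_on_dbl, of i A] by auto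
    then have dbl: "subset_poly (dbl ` insert i A) = Polynomial.monom 1 (dbl i) + subset_poly (dbl ` A)"
      using insert by (simp add: subset_poly_def)
    have double: "f + f = 0" for f :: "bit poly"
      by (simp flip: bit_poly_diff_eq_add)
    have "(subset_poly (insert i A))\<^sup>2 = (Polynomial.monom 1 i + subset_poly A)\<^sup>2"
      using insert by (simp add: subset_poly_def)
    also have "\<dots> = (Polynomial.monom 1 i)\<^sup>2 + (subset_poly A)\<^sup>2
        + (Polynomial.monom 1 i * subset_poly A + Polynomial.monom 1 i * subset_poly A)"
      by (simp add: power2_eq_square algebra_simps)
    also have "\<dots> = Polynomial.monom 1 (2 * i) + (subset_poly A)\<^sup>2"
      by (simp add: double monom_power mult.commute)
    finally have sq: "(subset_poly (insert i A))\<^sup>2 - subset_poly (dbl ` insert i A)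
        = (Polynomial.monom 1 (2 * i) - Polynomial.monom 1 (dbl i))
          + ((subset_poly A)\<^sup>2 - subset_poly (dbl ` A))"
      using dbl by simp
    have "all_ones_poly d dvd Polynomial.monom 1 (2 * i) - Polynomial.monom 1 (dbl i)"
    proof (cases "2 * i < p")
      case True
      then show ?thesis by (simp add: double_mod_def)
    next
      case False
      then obtain k where k: "2 * i = k + Suc d" by (metis p_eq le_Suc_ex add.commute not_less)
      have "k < Suc d" using insert.prems p_eq k by auto
      then have "dbl i = k"
        unfolding double_mod_def k p_eq by (simp only: mod_add_self2 mod_less)
      then show ?thesis using all_ones_dvd_monom_diff k by metis
    qed
    moreover have "all_ones_poly d dvd (subset_poly A)\<^sup>2 - subset_poly (dbl ` A)"
      using insert by auto
    ultimately show ?case unfolding sq by (rule dvd_add)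
  qed
  then show ?thesis by (simp add: residue_class_eq_iff)
qed

lemma map_cube_kernel:
  assumes "A \<subseteq> U"
  shows "map_pmf (subset_class d) (cube_kernel p d A) = square_kernel d (subset_class d A)"
proof -
  have finA: "finite A" using assms finite_subset by blast
  have "subset_class d (sym_diff (dbl ` A) E)
      = subset_class d A [^]\<^bsub>Fq d\<^esub> (2::nat) \<oplus>\<^bsub>Fq d\<^esub> subset_class d E"
    if "E \<in> set_pmf (cube_noise d)" for E
  proof -
    have "finite E" using that set_pmf_cube_noise finite_subset by blast
    then show ?thesis
      using finA assms
      by (simp add: residue_class_square subset_class_image_dbl residue_class_add subset_poly_sym_diff)
  qed
  then show ?thesis
    unfolding square_kernel_def cube_kernel_def noise_pmf_eq pmf.map_comp o_def
    by (intro map_pmf_cong refl) auto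
qed

text \<open>The cube walk projects onto the chain of squares: the projection intertwines the kernels.\<close>

lemma map_cube_walk:
  "map_pmf (subset_class d) (cube_walk p d n) = kernel_power (square_kernel d) n \<zero>\<^bsub>Fq d\<^esub>"
proof (induction n)
  case 0
  then show ?case by (simp add: subset_poly_def residue_class_0)
next
  case (Suc n)
  have "map_pmf (subset_class d) (cube_walk p d (Suc n))
      = bind_pmf (cube_walk p d n) (\<lambda>A. map_pmf (subset_class d) (cube_kernel p d A))"
    by (simp add: map_bind_pmf)
  also have "\<dots> = bind_pmf (cube_walk p d n) (\<lambda>A. square_kernel d (subset_class d A))"
    using set_pmf_cube_walk by (intro bind_pmf_cong refl map_cube_kernel) auto
  also have "\<dots> = kernel_power (square_kernel d) (Suc n) \<zero>\<^bsub>Fq d\<^esub>"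
    by (simp add: Suc[symmetric] bind_map_pmf)
  finally show ?case .
qed

lemma U_atMost: "U = {..d}"
  using p_eq by auto

text \<open>A polynomial of degree at most \<open>d\<close> that is divisible by \<open>1 + x + \<dots> + x\<^sup>d\<close> is a constant
  multiple of it, and the constants are 0 and 1.\<close>

lemma subset_class_eq_iff:
  assumes "A \<subseteq> U" "B \<subseteq> U"
  shows "subset_class d A = subset_class d B \<longleftrightarrow> B = A \<or> B = U - A"
proof -
  let ?D = "sym_diff A B"
  have fin: "finite A" "finite B" using assms finite_subset by blast+
  have DU: "?D \<subseteq> U" using assms by auto
  have "subset_class d A = subset_class d B \<longleftrightarrow> all_ones_poly d dvd subset_poly ?D"
    using fin by (simp add: residue_class_eq_iff bit_poly_diff_eq_add subset_poly_sym_diff)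
  also have "\<dots> \<longleftrightarrow> ?D = {} \<or> ?D = U"
  proof
    assume "all_ones_poly d dvd subset_poly ?D"
    then obtain k where k: "subset_poly ?D = all_ones_poly d * k" by (rule dvdE)
    show "?D = {} \<or> ?D = U"
    proof (cases "k = 0")
      case True
      then have "subset_poly ?D = subset_poly {}" using k by (simp add: subset_poly_def)
      then show ?thesis using fin by (subst (asm) subset_poly_eq_iff) auto
    next
      case False
      have "Polynomial.degree (subset_poly ?D) \<le> d"
        using fin DU by (intro degree_le) (auto simp: coeff_subset_poly U_atMost)
      moreover have "all_ones_poly d \<noteq> 0"
        using d_ge_2 degree_all_ones_poly[of d] by (metis Polynomial.degree_0 not_numeral_le_zero)
      ultimately have "Polynomial.degree k = 0"
        using False k degree_mult_eq[of "all_ones_poly d" k] by simp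
      then obtain c where c: "k = [:c:]" by (rule degree_eq_zeroE)
      then have "c = 1" using False by (cases c) auto
      then have "subset_poly ?D = subset_poly U"
        using k c U_atMost by (simp add: all_ones_poly_eq one_pCons[symmetric])
      then show ?thesis using fin by (subst (asm) subset_poly_eq_iff) auto
    qed
  next
    assume "?D = {} \<or> ?D = U"
    then have "subset_poly ?D = 0 \<or> subset_poly ?D = all_ones_poly d"
      by (elim disjE) (simp_all only: subset_poly_def all_ones_poly_eq U_atMost sum.empty simp_thms)
    then show "all_ones_poly d dvd subset_poly ?D" by auto
  qed
  also have "\<dots> \<longleftrightarrow> B = A \<or> B = U - A" using assms by auto
  finally show ?thesis .
qed

lemma carrier_Fq_eq_image: "carrier (Fq d) = subset_class d ` Pow U"
proof
  show "carrier (Fq d) \<subseteq> subset_class d ` Pow U"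
  proof
    fix \<alpha> assume "\<alpha> \<in> carrier (Fq d)"
    then obtain f where f: "\<alpha> = residue_class d f" by (auto simp: carrier_Fq)
    define r where "r = f mod all_ones_poly d"
    have ne: "all_ones_poly d \<noteq> 0"
      using d_ge_2 degree_all_ones_poly[of d] by (metis Polynomial.degree_0 not_numeral_le_zero)
    have deg: "r = 0 \<or> Polynomial.degree r < d"
      using degree_mod_less[OF ne, of f] by (simp add: r_def)
    define A where "A = {i \<in> U. poly.coeff r i = 1}"
    have "r = subset_poly A"
    proof (rule poly_eqI)
      fix i
      have "i \<notin> U \<Longrightarrow> poly.coeff r i = 0"
        using deg p_eq by (auto intro!: coeff_eq_0)
      then show "poly.coeff r i = poly.coeff (subset_poly A) i"
        by (auto simp: coeff_subset_poly A_def)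
    qed
    moreover have "all_ones_poly d dvd f - r" by (simp add: r_def dvd_minus_mod)
    ultimately have "\<alpha> = subset_class d A" using f by (simp add: residue_class_eq_iff)
    moreover have "A \<in> Pow U" by (auto simp: A_def)
    ultimately show "\<alpha> \<in> subset_class d ` Pow U" by blast
  qed
qed (auto simp: carrier_Fq)

text \<open>All fibres of the projection have the same size, namely 2.\<close>

lemma map_uniform_subset_class:
  "map_pmf (subset_class d) (pmf_of_set (Pow U)) = pmf_of_set (carrier (Fq d))"
proof -
  let ?P = "map_pmf (subset_class d) (pmf_of_set (Pow U))"
  let ?C = "carrier (Fq d)"
  have finC: "finite ?C" and neC: "?C \<noteq> {}"
    using Pow_not_empty[of U] by (simp_all add: carrier_Fq_eq_image)
  have setP: "set_pmf ?P = ?C"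
    using Pow_not_empty[of U] by (simp add: carrier_Fq_eq_image)
  have const: "pmf ?P \<alpha> = 2 / 2 ^ p" if "\<alpha> \<in> ?C" for \<alpha>
  proof -
    from that obtain A where A: "A \<subseteq> U" "\<alpha> = subset_class d A"
      unfolding carrier_Fq_eq_image by blast
    have fiber: "subset_class d B = \<alpha> \<longleftrightarrow> B = A \<or> B = U - A" if "B \<subseteq> U" for B
      unfolding A(2) using subset_class_eq_iff[OF A(1) that] by (subst eq_commute)
    have "pmf ?P \<alpha> = (\<Sum>B | B \<in> Pow U \<and> subset_class d B = \<alpha>. pmf (pmf_of_set (Pow U)) B)"
      using Pow_not_empty[of U] by (intro pmf_map_eq_sum) auto
    also have "{B. B \<in> Pow U \<and> subset_class d B = \<alpha>} = {A, U - A}"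
    proof (intro Set.set_eqI iffI)
      fix B assume "B \<in> {A, U - A}"
      then have "B \<subseteq> U" "B = A \<or> B = U - A" using A(1) by auto
      then show "B \<in> {B. B \<in> Pow U \<and> subset_class d B = \<alpha>}" using fiber by simp
    qed (use fiber in auto)
    also have "(\<Sum>B\<in>{A, U - A}. pmf (pmf_of_set (Pow U)) B) = (\<Sum>B\<in>{A, U - A}. 1 / 2 ^ p)"
      using A Pow_not_empty[of U] by (intro sum.cong) (auto simp: card_Pow)
    also have "\<dots> = card {A, U - A} * (1 / 2 ^ p)" by simp
    also have "A \<noteq> U - A" using A d_less_p by blast
    then have "card {A, U - A} = 2" by simp
    finally show ?thesis by simp
  qed
  have "(\<Sum>\<alpha>\<in>?C. pmf ?P \<alpha>) = 1" using finC setP by (intro sum_pmf_eq_1) auto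
  also have "(\<Sum>\<alpha>\<in>?C. pmf ?P \<alpha>) = (\<Sum>\<alpha>\<in>?C. 2 / 2 ^ p)"
    by (rule sum.cong[OF refl const])
  finally have "card ?C * (2 / 2 ^ p :: real) = 1" by (simp only: sum_constant)
  then have "2 / 2 ^ p = inverse (real (card ?C))" by (rule inverse_unique[symmetric])
  then have "2 / 2 ^ p = 1 / real (card ?C)" by (simp only: inverse_eq_divide)
  show ?thesis
  proof (rule pmf_eqI)
    fix \<alpha>
    show "pmf ?P \<alpha> = pmf (pmf_of_set ?C) \<alpha>"
    proof (cases "\<alpha> \<in> ?C")
      case True
      then show ?thesis
        using const \<open>2 / 2 ^ p = 1 / real (card ?C)\<close> finC neC by simp
    next
      case False
      then have "\<alpha> \<notin> set_pmf ?P" by (simp only: setP not_False_eq_True)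
      then have "pmf ?P \<alpha> = 0" by (simp only: set_pmf_iff not_not)
      then show ?thesis using False finC neC by simp
    qed
  qed
qed

lemma tv_from_uniform_eq:
  "tv_from_uniform d n = tv_dist (subset_class d ` Pow U)
     (map_pmf (subset_class d) (cube_walk p d n)) (map_pmf (subset_class d) (pmf_of_set (Pow U)))"
  unfolding tv_from_uniform_def map_cube_walk map_uniform_subset_class carrier_Fq_eq_image ..

end

section \<open>Bounds on the mixing time\<close>

context primroot2
begin

lemma integrable_on_subsets:
  fixes f :: "nat set \<Rightarrow> real"
  assumes "set_pmf P \<subseteq> Pow U"
  shows "integrable P f"
  using finite_subset[OF assms] by (intro integrable_measure_pmf_finite) simp

text \<open>This is \<open>p\<close> minus twice the size of the set. Passing to the complement changes its sign,
  so its absolute value is a function on the quotient ring.\<close>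

definition signed_sum :: "nat set \<Rightarrow> real" where
  "signed_sum A = (\<Sum>i<p. chi {i} A)"

lemma signed_sum_compl:
  assumes "A \<subseteq> U"
  shows "signed_sum (U - A) = - signed_sum A"
proof -
  have "chi {i} (U - A) = - chi {i} A" if "i \<in> U" for i
    using that by (simp add: chi_singleton)
  then show ?thesis by (simp add: signed_sum_def sum_negf)
qed

lemma expectation_signed_sum:
  assumes "set_pmf P \<subseteq> Pow U"
  shows "measure_pmf.expectation P signed_sum = (\<Sum>i<p. fourier P {i})"
proof -
  show ?thesis
    using integrable_on_subsets[OF assms] by (simp add: signed_sum_def[abs_def] fourier_def)
qed

lemma expectation_signed_sum_square:
  assumes "set_pmf P \<subseteq> Pow U"
  shows "measure_pmf.expectation P (\<lambda>A. (signed_sum A)\<^sup>2)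
    = p + (\<Sum>i<p. \<Sum>j\<in>U - {i}. fourier P {i, j})"
proof -
  have "(signed_sum A)\<^sup>2 = p + (\<Sum>i<p. \<Sum>j\<in>U - {i}. chi {i, j} A)" for A
  proof -
    have "(signed_sum A)\<^sup>2 = (\<Sum>i<p. \<Sum>j<p. chi {i} A * chi {j} A)"
      by (simp add: signed_sum_def power2_eq_square sum_product)
    also have "\<dots> = (\<Sum>i<p. 1 + (\<Sum>j\<in>U - {i}. chi {i, j} A))"
    proof (rule sum.cong[OF refl])
      fix i assume "i \<in> U"
      then have "(\<Sum>j<p. chi {i} A * chi {j} A)
          = chi {i} A * chi {i} A + (\<Sum>j\<in>U - {i}. chi {i} A * chi {j} A)"
        by (intro sum.remove) auto
      also have "(\<Sum>j\<in>U - {i}. chi {i} A * chi {j} A) = (\<Sum>j\<in>U - {i}. chi {i, j} A)"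
        by (intro sum.cong refl) (subst chi_Un_disjoint[symmetric], auto simp: insert_commute)
      finally show "(\<Sum>j<p. chi {i} A * chi {j} A) = 1 + (\<Sum>j\<in>U - {i}. chi {i, j} A)"
        by simp
    qed
    finally show ?thesis by (simp add: sum.distrib)
  qed
  then show ?thesis
    using integrable_on_subsets[OF assms] by (simp add: fourier_def)
qed

text \<open>The variances of the \<open>p\<close> signs are at most 1, and their covariances are nonpositive.\<close>

lemma cube_walk_variance_signed_sum:
  "measure_pmf.variance (cube_walk p d n) signed_sum \<le> p"
proof -
  let ?P = "cube_walk p d n"
  have "(\<Sum>i<p. \<Sum>j\<in>U - {i}. fourier ?P {i, j})
      \<le> (\<Sum>i<p. \<Sum>j\<in>U - {i}. fourier ?P {i} * fourier ?P {j})"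
  proof (intro sum_mono)
    fix i j assume "i \<in> U" "j \<in> U - {i}"
    then show "fourier ?P {i, j} \<le> fourier ?P {i} * fourier ?P {j}"
      using fourier_cube_walk_Un_le[of "{i}" "{j}" n] by (auto simp: insert_commute)
  qed
  also have "\<dots> \<le> (\<Sum>i<p. \<Sum>j<p. fourier ?P {i} * fourier ?P {j})"
    by (intro sum_mono sum_mono2 mult_nonneg_nonneg fourier_cube_walk_nonneg) auto
  also have "\<dots> = (measure_pmf.expectation ?P signed_sum)\<^sup>2"
    by (simp add: expectation_signed_sum[OF set_pmf_cube_walk] power2_eq_square sum_product)
  finally show ?thesis
    using integrable_on_subsets[OF set_pmf_cube_walk]
    by (simp add: measure_pmf.variance_eq expectation_signed_sum_square[OF set_pmf_cube_walk])
qed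

lemma fourier_uniform:
  assumes "S \<subseteq> U" "S \<noteq> {}"
  shows "fourier (pmf_of_set (Pow U)) S = 0"
proof -
  have "(\<Sum>A\<in>Pow U. chi S A) = (\<Sum>A\<in>Pow U. chi A S)" by (simp add: chi_commute)
  also have "\<dots> = 0" using assms by (subst sum_chi) auto
  finally show ?thesis
    using Pow_not_empty[of U] by (simp add: fourier_def integral_pmf_of_set)
qed

lemma prob_uniform_signed_sum_large:
  assumes "\<mu> > 0"
  shows "measure_pmf.prob (pmf_of_set (Pow U)) {A. \<bar>signed_sum A\<bar> > \<mu> / 2} \<le> 4 * p / \<mu>\<^sup>2"
proof -
  let ?Q = "pmf_of_set (Pow U)"
  have setQ: "set_pmf ?Q = Pow U" using Pow_not_empty[of U] by simp
  note int = integrable_on_subsets[of ?Q]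
  have "measure_pmf.prob ?Q {A. \<bar>signed_sum A\<bar> > \<mu> / 2}
      \<le> measure_pmf.prob ?Q {A \<in> space ?Q. (\<mu> / 2)\<^sup>2 \<le> (signed_sum A)\<^sup>2}"
    using assms by (intro measure_pmf.finite_measure_mono) (auto simp: abs_le_square_iff[symmetric])
  also have "\<dots> \<le> measure_pmf.expectation ?Q (\<lambda>A. (signed_sum A)\<^sup>2) / (\<mu> / 2)\<^sup>2"
    using assms int setQ by (intro integral_Markov_inequality_measure[where A = "{}"]) auto
  also have "measure_pmf.expectation ?Q (\<lambda>A. (signed_sum A)\<^sup>2) = p"
    using setQ by (simp add: expectation_signed_sum_square fourier_uniform)
  finally show ?thesis by (simp add: power_divide mult.commute)
qed

text \<open>The distinguishing event is that the absolute signed sum exceeds half of a lower bound for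
  its mean under the chain. Chebyshev makes it likely for the chain, Markov makes it unlikely
  under the uniform law, where the second moment of the signed sum is \<open>p\<close>.\<close>

lemma tv_from_uniform_ge:
  assumes "\<mu> > 0" "\<mu> \<le> (\<Sum>i<p. fourier (cube_walk p d n) {i})"
  shows "1 - 8 * p / \<mu>\<^sup>2 \<le> tv_from_uniform d n"
proof -
  let ?P = "cube_walk p d n" and ?Q = "pmf_of_set (Pow U)"
  let ?f = "subset_class d"
  let ?L = "{A. \<bar>signed_sum A\<bar> > \<mu> / 2}"
  let ?E = "?f ` (Pow U \<inter> ?L)"
  have setQ: "set_pmf ?Q = Pow U" using Pow_not_empty[of U] by simp
  note int = integrable_on_subsets[OF set_pmf_cube_walk]
  have in_image: "?f A \<in> ?E \<longleftrightarrow> A \<in> ?L" if A: "A \<subseteq> U" for A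
  proof
    assume "?f A \<in> ?E"
    then obtain B where "B \<subseteq> U" "B \<in> ?L" "?f A = ?f B" by blast
    then show "A \<in> ?L"
      using subset_class_eq_iff[OF A, of B] signed_sum_compl[OF A] by auto
  qed (use A in blast)
  have prob: "measure_pmf.prob (map_pmf ?f R) ?E = measure_pmf.prob R ?L" if R: "set_pmf R \<subseteq> Pow U" for R
  proof -
    have "A \<in> ?f -` ?E \<longleftrightarrow> A \<in> ?L" if "A \<in> set_pmf R" for A
      unfolding vimage_eq using that R by (intro in_image) blast
    then have "?f -` ?E \<inter> set_pmf R = ?L \<inter> set_pmf R"
      by (intro Set.set_eqI) (meson Int_iff)
    then have "measure_pmf.prob R (?f -` ?E) = measure_pmf.prob R ?L"
      by (metis measure_Int_set_pmf)
    then show ?thesis by (simp only: measure_map_pmf)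
  qed
  have "measure_pmf.prob ?P {A \<in> space ?P. \<bar>signed_sum A\<bar> \<le> \<mu> / 2}
      \<le> 4 * measure_pmf.variance ?P signed_sum / \<mu>\<^sup>2"
    using assms int
    by (intro measure_pmf.prob_abs_le_half_mean) (auto simp: expectation_signed_sum[OF set_pmf_cube_walk])
  also have "\<dots> \<le> 4 * p / \<mu>\<^sup>2"
    using cube_walk_variance_signed_sum by (intro divide_right_mono mult_left_mono) auto
  finally have "measure_pmf.prob ?P (- ?L) \<le> 4 * p / \<mu>\<^sup>2"
    by (simp add: Collect_neg_eq[symmetric] not_less)
  then have "measure_pmf.prob ?P ?L \<ge> 1 - 4 * p / \<mu>\<^sup>2"
    using measure_pmf.prob_compl[of ?L ?P] by (simp add: Compl_eq_Diff_UNIV)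
  moreover have "measure_pmf.prob (map_pmf ?f ?P) ?E - measure_pmf.prob (map_pmf ?f ?Q) ?E
      \<le> tv_from_uniform d n"
    unfolding tv_from_uniform_eq using set_pmf_cube_walk setQ
    by (intro prob_diff_le_tv_dist) auto
  ultimately show ?thesis
    using prob_uniform_signed_sum_large[OF assms(1)] prob[OF set_pmf_cube_walk] prob[of ?Q] setQ
    by simp
qed

text \<open>For \<open>n = d (ln d - c) / 2\<close> the mean of the signed sum is at least of order
  \<open>sqrt p * exp (c/2)\<close>, whereas the standard deviations are at most \<open>sqrt p\<close>.\<close>

lemma tv_from_uniform_lower_bound:
  assumes n: "real n = 1/2 * real d * (ln (real d) - c)" and c: "c > 0"
  shows "1 - 8 * exp 2 * exp (- c) \<le> tv_from_uniform d n"
proof -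
  define D where "D = real d"
  have D: "D \<ge> 2" using d_ge_2 by (simp add: D_def)
  define \<mu> where "\<mu> = p * (1 - 1 / D) ^ n"
  have p: "real p > 0" "D \<le> p" using p_eq by (simp_all add: D_def)
  have \<mu>: "\<mu> > 0" using D p by (simp add: \<mu>_def)
  have "(\<Sum>i<p. (1 - 1 / D) ^ n) \<le> (\<Sum>i<p. fourier (cube_walk p d n) {i})"
    unfolding D_def by (intro sum_mono fourier_cube_walk_singleton_ge) auto
  then have le: "1 - 8 * p / \<mu>\<^sup>2 \<le> tv_from_uniform d n"
    using \<mu> by (intro tv_from_uniform_ge) (simp_all add: \<mu>_def)
  have n': "2 * real n = D * (ln D - c)" using n by (simp add: D_def)
  have lnD: "ln D \<le> D" using D ln_le_minus_one[of D] by linarith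
  \<comment> \<open>the second-order term of the logarithm costs only a constant because \<open>ln D \<le> D\<close>\<close>
  have "- (ln D - c) - 2 \<le> 2 * real n * (- (1 / D) - 2 * (1 / D)\<^sup>2)"
  proof -
    have "2 * real n * (- (1 / D) - 2 * (1 / D)\<^sup>2) = - (2 * real n / D) - 2 * (2 * real n / D / D)"
      using D by (simp add: power2_eq_square field_simps)
    also have "2 * real n / D = ln D - c" using D by (simp add: n')
    finally have "2 * real n * (- (1 / D) - 2 * (1 / D)\<^sup>2) = - (ln D - c) - 2 * ((ln D - c) / D)" .
    moreover have "(ln D - c) / D \<le> 1" using lnD c D by simp
    ultimately show ?thesis by linarith
  qed
  also have "\<dots> \<le> 2 * real n * ln (1 - 1 / D)"
    using D by (intro mult_left_mono ln_one_minus_pos_lower_bound) auto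
  finally have "exp (- (ln D - c) - 2) \<le> exp (2 * real n * ln (1 - 1 / D))" by simp
  also have "\<dots> = ((1 - 1 / D) ^ n)\<^sup>2"
  proof -
    have "exp (real (2 * n) * ln (1 - 1 / D)) = exp (ln (1 - 1 / D)) ^ (2 * n)"
      by (rule exp_of_nat_mult)
    then show ?thesis using D by (simp add: power_mult mult.commute flip: power_mult)
  qed
  finally have sq: "exp (- (ln D - c) - 2) \<le> ((1 - 1 / D) ^ n)\<^sup>2" .
  have "p / \<mu>\<^sup>2 = 1 / (p * ((1 - 1 / D) ^ n)\<^sup>2)"
    using p by (simp add: \<mu>_def power2_eq_square)
  also have "\<dots> \<le> 1 / (D * exp (- (ln D - c) - 2))"
    using sq p D by (intro divide_left_mono mult_mono mult_pos_pos) auto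
  also have "\<dots> = exp 2 * exp (- c)"
    using D by (simp add: exp_add exp_diff exp_minus field_simps)
  finally show ?thesis using le by simp
qed

text \<open>Each element of an index set contributes about \<open>exp (- 2 n / d) = exp (- c) / d\<close> to the
  squared coefficients, so their sum over the nonempty sets is at most about
  \<open>exp (exp (- c)) - 1\<close>. The correction terms are absorbed by halving \<open>c\<close> and by the constant
  \<open>K\<close>.\<close>

lemma tv_from_uniform_upper_bound:
  assumes n: "real n = 1/2 * real d * (ln (real d) + c)" and c: "c > 0"
  defines "K \<equiv> 2 * exp (2::real)"
  shows "tv_from_uniform d n \<le> sqrt (K * exp K) * exp (- (1/4) * c)"
proof -
  define D where "D = real d"
  have D: "D \<ge> 2" using d_ge_2 by (simp add: D_def)
  let ?Q = "pmf_of_set (Pow U)"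
  let ?T = "tv_dist (Pow U) (cube_walk p d n) ?Q"
  define z where "z = exp (- (real n - real n / d - 1) / d)"
  have setQ: "set_pmf ?Q = Pow U" using Pow_not_empty[of U] by simp
  have "K > 0" by (simp add: K_def)
  have z2: "p * z\<^sup>2 \<le> K * exp (- c / 2)"
  proof -
    have "2 * real n / D = ln D + c" using n D by (simp add: D_def field_simps)
    have "2 * (- (real n - real n / d - 1) / d) = - (2 * real n / D) + (2 * real n / D) / D + 2 / D"
      using D by (simp add: D_def field_simps)
    also have "\<dots> = - (ln D + c) + ln D / D + c / D + 2 / D"
      by (simp add: \<open>2 * real n / D = ln D + c\<close> add_divide_distrib)
    \<comment> \<open>for \<open>d = 2\<close> the term \<open>c / D\<close> really removes half of the decay\<close>
    also have "\<dots> \<le> - (ln D + c) + 1 + c / 2 + 1"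
      using D c ln_le_minus_one[of D] by (intro add_mono frac_le) (auto simp: divide_le_eq)
    finally have "z\<^sup>2 \<le> exp (2 - ln D - c / 2)"
      unfolding z_def exp_double[symmetric] by simp
    also have "2 - ln D - c / 2 = 2 + - c / 2 - ln D" by simp
    also have "exp \<dots> = exp 2 * exp (- c / 2) / exp (ln D)" by (simp only: exp_diff exp_add)
    also have "exp (ln D) = D" using D by simp
    finally have "p * z\<^sup>2 \<le> p * (exp 2 * exp (- c / 2) / D)"
      by (rule mult_left_mono) simp
    also have "\<dots> \<le> (2 * D) * (exp 2 * exp (- c / 2) / D)"
      using D p_eq by (intro mult_right_mono) (auto simp: D_def)
    finally show ?thesis using D by (simp add: K_def)
  qed
  have "(2 * ?T)\<^sup>2 \<le> (\<Sum>S\<in>Pow U - {{}}. (fourier (cube_walk p d n) S)\<^sup>2)"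
    by (intro tv_uniform_fourier_bound set_pmf_cube_walk) simp
  also have "\<dots> \<le> (\<Sum>S\<in>Pow U - {{}}. (z\<^sup>2) ^ card S)"
  proof (intro sum_mono)
    fix S assume "S \<in> Pow U - {{}}"
    then have "(fourier (cube_walk p d n) S)\<^sup>2 \<le> (z ^ card S)\<^sup>2"
      unfolding z_def by (intro power_mono fourier_cube_walk_le fourier_cube_walk_nonneg) auto
    then show "(fourier (cube_walk p d n) S)\<^sup>2 \<le> (z\<^sup>2) ^ card S"
      by (simp add: power_mult[symmetric] mult.commute)
  qed
  also have "\<dots> = (1 + z\<^sup>2) ^ p - 1"
    by (simp add: sum_powers_nonempty_subsets)
  also have "\<dots> \<le> exp (z\<^sup>2) ^ p - 1"
    using exp_ge_add_one_self[of "z\<^sup>2"] by (intro diff_right_mono power_mono) auto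
  also have "\<dots> = exp (p * z\<^sup>2) - 1"
    by (simp add: exp_of_nat_mult)
  also have "\<dots> \<le> exp (K * exp (- c / 2)) - 1" using z2 by simp
  also have "\<dots> \<le> (K * exp (- c / 2)) * exp (K * exp (- c / 2))"
  proof -
    have "exp y - 1 \<le> y * exp y" for y :: real
    proof -
      have "(1 - y) * exp y \<le> exp (- y) * exp y"
        using exp_ge_add_one_self[of "- y"] by (intro mult_right_mono) auto
      then show ?thesis by (simp add: algebra_simps exp_minus)
    qed
    then show ?thesis .
  qed
  also have "\<dots> \<le> (K * exp (- c / 2)) * exp K"
    using \<open>K > 0\<close> c by (intro mult_left_mono) auto
  finally have "(2 * ?T)\<^sup>2 \<le> K * exp K * exp (- c / 2)" by (simp only: mult_ac)
  also have "\<dots> = (sqrt (K * exp K) * exp (- (1/4) * c))\<^sup>2"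
    using \<open>K > 0\<close> by (simp add: power_mult_distrib exp_double[symmetric])
  finally have "2 * ?T \<le> sqrt (K * exp K) * exp (- (1/4) * c)"
    by (rule power2_le_imp_le) (use \<open>K > 0\<close> in simp)
  moreover have "tv_from_uniform d n \<le> ?T"
    unfolding tv_from_uniform_eq using set_pmf_cube_walk setQ by (intro tv_dist_map_le) auto
  moreover have "0 \<le> ?T" by (rule tv_dist_nonneg)
  ultimately show ?thesis by linarith
qed

end

theorem theorem1p1:
  shows "\<exists>a a' b :: real. a > 0 \<and> a' > 0 \<and> b > 0 \<and>
    (\<forall>p d :: nat. Factorial_Ring.prime p \<longrightarrow> residue_primroot p 2 \<longrightarrow> d = p - 1 \<longrightarrow>
      (\<forall>(c::real) (n::nat). c > 0 \<longrightarrow> real n = 1/2 * real d * (ln (real d) + c) \<longrightarrow>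
         tv_from_uniform d n \<le> a * exp (- b * c)) \<and>
      (\<forall>(c::real) (n::nat). c > 0 \<longrightarrow> real n = 1/2 * real d * (ln (real d) - c) \<longrightarrow>
         tv_from_uniform d n \<ge> 1 - a' * exp (- b * c)))"
proof -
  define K :: real where "K = 2 * exp 2"
  define a where "a = sqrt (K * exp K)"
  have "K > 0" by (simp add: K_def)
  then have "a > 0" by (simp add: a_def)
  moreover have
    "tv_from_uniform d n \<le> a * exp (- (1/4) * c)"
    if "Factorial_Ring.prime p" "residue_primroot p 2" "d = p - 1" "c > 0"
      "real n = 1/2 * real d * (ln (real d) + c)" for p d n :: nat and c :: real
  proof -
    interpret primroot2 p d by unfold_locales (use that prime_gt_0_nat[of p] in simp_all)
    show ?thesis unfolding a_def K_def by (rule tv_from_uniform_upper_bound) fact+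
  qed
  moreover have
    "1 - 8 * exp 2 * exp (- (1/4) * c) \<le> tv_from_uniform d n"
    if "Factorial_Ring.prime p" "residue_primroot p 2" "d = p - 1" "c > 0"
      "real n = 1/2 * real d * (ln (real d) - c)" for p d n :: nat and c :: real
  proof -
    interpret primroot2 p d by unfold_locales (use that prime_gt_0_nat[of p] in simp_all)
    have "1 - 8 * exp 2 * exp (- (1/4) * c) \<le> 1 - 8 * exp 2 * exp (- c)"
      using \<open>c > 0\<close> by simp
    also have "\<dots> \<le> tv_from_uniform d n" by (rule tv_from_uniform_lower_bound) fact+
    finally show ?thesis .
  qed
  ultimately show ?thesis
    by (intro exI[of _ a] exI[of _ "8 * exp 2"] exI[of _ "1/4"]) auto
qed

end
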